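(* Let $n$ be a positive integer, let $l$ be an integer such that $l$ and $n$ are relatively prime, and let $j\in\{0,1,\ldots,n-1\}$. Then for all $k,a,m\in\mathbb{C}$ (for which the functions below are defined), $$\sum_{p=0}^{n-1}e^{-\frac{2ij(\pi l p+mn)}{n}}\left(\Phi\left(e^{\frac{2i(mn+lp\pi)}{n}},-k,-j-\tfrac{1}{2}i\log(a)\right)+e^{2i(2j+1)\left(\frac{\pi l p}{n}+m\right)}\,\Phi\left(e^{\frac{2i(mn+lp\pi)}{n}},-k,\,j-\tfrac{1}{2}i\log(a)+1\right)\right)$$ $$=(2i)^{-k}\,n\left(\log^k(a)+2^{k+1}(in)^k e^{2imn}\,\Phi\left(e^{2imn},-k,\,1-\tfrac{i\log(a)}{2n}\right)\right).$$
   Context: $\Phi(z,s,v)$ is the Hurwitz-Lerch zeta function (Lerch function), a generalization of the Hurwitz zeta function and of the polylogarithm. It has the series representation $$\Phi(z,s,v)=\sum_{r=0}^{\infty}(v+r)^{-s}z^{r},\qquad |z|<1,\ v\neq 0,-1,-2,\ldots,$$ and is continued analytically by its integral representation $$\Phi(z,s,v)=\frac{1}{\Gamma(s)}\int_0^\infty\frac{t^{s-1}e^{-vt}}{1-ze^{-t}}\,dt=\frac{1}{\Gamma(s)}\int_0^\infty\frac{t^{s-1}e^{-(v-1)t}}{e^{t}-z}\,dt,$$ where $\mathrm{Re}(v)>0$ and either $|z|\le 1$, $z\neq 1$, $\mathrm{Re}(s)>0$, or $z=1$, $\mathrm{Re}(s)>1$. Here $\log^k(a)$ means $(\log a)^k$,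 and $i$ is the imaginary unit.
   Formalization: log^k(a) is taken with the argument of log(a) in (-π/2, 3π/2], so that (2i)^{-k} log^k(a) is the principal k-th power of log(a)/(2i); with principal log^k(a) the identity fails, e.g. n=1, j=0, a=-i, k=1/2. *)

theory Defs
  imports "HOL-Analysis.Analysis"
begin

text \<open>
  The Hurwitz-Lerch zeta function, with principal powers \<open>(v + r) powr (-s)\<close>. The integral
  representation requires \<open>Re v > 0\<close>; it is continued to the other admissible \<open>v\<close> by the
  recurrence \<open>\<Phi>(z,s,v) = v powr (-s) + z * \<Phi>(z,s,v+1)\<close>, which on the open disc is immediate from
  the series. For \<open>Re v > 0\<close> the shift \<open>N\<close> below is 0.
\<close>

definition lerch_series :: "complex \<Rightarrow> complex \<Rightarrow> complex \<Rightarrow> complex" where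
  "lerch_series z s v = (\<Sum>r. (v + of_nat r) powr (-s) * z ^ r)"

definition lerch_integral :: "complex \<Rightarrow> complex \<Rightarrow> complex \<Rightarrow> complex" where
  "lerch_integral z s v =
     1 / Gamma s *
     integral {0..} (\<lambda>t::real. of_real t powr (s - 1) * exp (- v * of_real t)
                                / (1 - z * exp (- of_real t)))"

definition lerch_phi :: "complex \<Rightarrow> complex \<Rightarrow> complex \<Rightarrow> complex" where
  "lerch_phi z s v =
     (if norm z < 1 then lerch_series z s v
      else let N = (LEAST N::nat. Re v + real N > 0)
           in (\<Sum>r<N. (v + of_nat r) powr (-s) * z ^ r) + z ^ N * lerch_integral z s (v + of_nat N))"

definition lerch_defined :: "complex \<Rightarrow> complex \<Rightarrow> complex \<Rightarrow> bool" where
  "lerch_defined z s v \<longleftrightarrow>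
     v \<notin> \<int>\<^sub>\<le>\<^sub>0 \<and>
     (norm z < 1 \<or> norm z \<le> 1 \<and> z \<noteq> 1 \<and> Re s > 0 \<or> z = 1 \<and> Re s > 1)"

lemma lerch_phi_eq_series: "norm z < 1 \<Longrightarrow> lerch_phi z s v = lerch_series z s v"
  by (simp add: lerch_phi_def)

lemma lerch_phi_eq_integral:
  assumes "norm z \<ge> 1" "Re v > 0"
  shows "lerch_phi z s v = lerch_integral z s v"
proof -
  have "(LEAST N::nat. Re v + real N > 0) = 0"
    using assms(2) by (intro Least_eq_0) simp
  with assms(1) show ?thesis by (simp add: lerch_phi_def Let_def)
qed

text \<open>
  The power \<open>w\<^sup>k\<close> with argument of \<open>w\<close> in \<open>(-\<pi>/2, 3\<pi>/2]\<close>, i.e. cut along the negative imaginary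
  axis. With this branch \<open>(2i)\<^sup>-\<^sup>k w\<^sup>k\<close> is the principal power \<open>(w/(2i))\<^sup>k\<close>, which for \<open>w = log a\<close> is
  the power of \<open>-(i/2) log a\<close> that occurs in the Lerch function. With the principal power of
  \<open>log a\<close> instead, the two differ by the factor \<open>exp (2\<pi>ik)\<close> when \<open>Arg (log a) \<le> -\<pi>/2\<close>.
  The lemmas below record these facts; the two branches agree also for integer \<open>k\<close>.
\<close>

definition ipowr :: "complex \<Rightarrow> complex \<Rightarrow> complex" where
  "ipowr w k = (if w = 0 then 0 else exp (k * (Ln (w / \<i>) + \<i> * of_real (pi / 2))))"

lemma ipowr_eq_powr:
  assumes "Arg w > - (pi / 2)"
  shows "ipowr w k = w powr k"
proof (cases "w = 0")
  case False
  have "Im (Ln w) > - (pi / 2)" "Im (Ln w) \<le> pi"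
    using assms False Im_Ln_le_pi by (auto simp: Arg_eq_Im_Ln)
  then have "Ln (w * - \<i>) = Ln w + Ln (- \<i>)"
    using False by (intro Ln_times_simple) auto
  then have "Ln (w / \<i>) + \<i> * of_real (pi / 2) = Ln w"
    by (simp add: mult.commute)
  with False show ?thesis unfolding ipowr_def powr_def by (simp only: if_False)
qed (simp add: ipowr_def)

lemma ipowr_of_int: "ipowr w (of_int k) = w powr (of_int k)"
proof (cases "w = 0")
  case False
  have e: "exp (\<i> * of_real (pi / 2)) = \<i>"
    by (metis cis_conv_exp cis_pi_half)
  have *: "exp (Ln (w / \<i>) + \<i> * of_real (pi / 2)) = w"
    using False exp_Ln[of "w / \<i>"] unfolding exp_add e by (simp del: divide_i)
  have "exp (of_int k * (Ln (w / \<i>) + \<i> * of_real (pi / 2))) = w powi k"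
    unfolding exp_power_int [symmetric] * ..
  moreover have "w powr (of_int k) = w powi k"
    using False by (intro complex_powr_of_int) simp
  ultimately show ?thesis
    using False unfolding ipowr_def by (simp only: if_False)
qed (simp add: ipowr_def)

lemma ipowr_two_ii:
  assumes "w \<noteq> 0"
  shows "(2 * \<i>) powr (- k) * ipowr w k = (w / (2 * \<i>)) powr k"
proof -
  have 1: "Ln (2 * \<i>) = of_real (ln 2) + \<i> * of_real (pi / 2)"
    using Ln_times_of_real[of 2 \<i>] Ln_of_real[of 2] by simp
  have "w / (2 * \<i>) = (w / \<i>) / of_real 2"
    by simp
  then have 2: "Ln (w / (2 * \<i>)) = Ln (w / \<i>) - of_real (ln 2)"
    using Ln_divide_of_real[of 2 "w / \<i>"] Ln_of_real[of 2] assms by simp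
  have 3: "- k * (of_real (ln 2) + \<i> * of_real (pi / 2)) + k * (L + \<i> * of_real (pi / 2)) =
           k * (L - of_real (ln 2))" for L :: complex
    by (simp only: ring_distribs) algebra
  have "(2 * \<i>) powr (- k) * ipowr w k =
        exp (- k * Ln (2 * \<i>) + k * (Ln (w / \<i>) + \<i> * of_real (pi / 2)))"
    unfolding exp_add[of "- k * Ln (2 * \<i>)"] using assms by (simp only: powr_def ipowr_def) simp
  also have "\<dots> = exp (k * Ln (w / (2 * \<i>)))"
    unfolding 1 2 3 ..
  finally show ?thesis
    using assms by (simp add: powr_def)
qed

end

theory Submission
  imports Defs
begin

text \<open>
  Put \<open>u = log a / (2i)\<close> and let \<open>z\<close> run over the numbers \<open>q \<zeta>\<^sup>p\<close>, where \<open>q = exp (2im)\<close> and \<open>\<zeta>\<close> is a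
  primitive \<open>n\<close>-th root of unity. Formally, \<open>z\<^sup>i \<Phi>(z, -k, u + i)\<close> is the sum of \<open>(u + r)\<^sup>k z\<^sup>r\<close> over
  all integers \<open>r \<ge> i\<close>. Summing over \<open>p\<close> removes every \<open>r\<close> that is not a multiple of \<open>n\<close>, and what
  remains is a Lerch function at \<open>q\<^sup>n\<close>. The two Lerch terms of the theorem are the cases \<open>i = -j\<close> and
  \<open>i = j + 1\<close>, whose first surviving multiples of \<open>n\<close> are \<open>0\<close> and \<open>n\<close>.

  On the unit circle the series may diverge. There \<open>\<Phi>\<close> is split into a finite initial segment, to
  which the same argument applies, and an integral, for which the sum over \<open>p\<close> is the partial
  fraction decomposition of \<open>n / (1 - w\<^sup>n)\<close>. The splitting can be made at any index because the
  integral satisfies the recurrence of \<open>\<Phi>\<close>; this is the Laplace transform of \<open>t\<^sup>s\<^sup>-\<^sup>1\<close>.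
\<close>

subsection \<open>The Laplace transform of complex powers\<close>

text \<open>Used twice: to bring a positive real parameter into the Gamma integral, and to rescale
  by \<open>n\<close> in the multiplication formula.\<close>

lemma absolutely_integrable_scale_Ioi:
  fixes f :: "real \<Rightarrow> 'a :: euclidean_space"
  assumes "f absolutely_integrable_on {0<..}" and "c > 0"
  shows "(\<lambda>t. f (c * t)) absolutely_integrable_on {0<..}"
    and "integral {0<..} (\<lambda>t. f (c * t)) = integral {0<..} f /\<^sub>R c"
proof -
  have img: "(*) c ` {0<..} = {0<..}"
  proof -
    have "y \<in> (*) c ` {0<..}" if "y > 0" for y
      using that assms(2) by (intro image_eqI[of _ _ "y / c"]) auto
    then show ?thesis using assms(2) by auto
  qed
  have "(\<lambda>t. \<bar>c\<bar> *\<^sub>R f (c * t)) absolutely_integrable_on {0<..} \<and>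
        integral {0<..} (\<lambda>t. \<bar>c\<bar> *\<^sub>R f (c * t)) = integral {0<..} f"
    by (subst has_absolute_integral_change_of_variables_real)
       (use assms img in \<open>auto intro!: derivative_eq_intros inj_onI\<close>)
  then have 1: "(\<lambda>t. c *\<^sub>R f (c * t)) absolutely_integrable_on {0<..}"
    and 2: "integral {0<..} (\<lambda>t. c *\<^sub>R f (c * t)) = integral {0<..} f"
    using assms(2) by auto
  from set_integrable_scaleR_right[OF 1, of "inverse c"] 
  show "(\<lambda>t. f (c * t)) absolutely_integrable_on {0<..}"
    using assms(2) by simp
  show "integral {0<..} (\<lambda>t. f (c * t)) = integral {0<..} f /\<^sub>R c"
    using 2 assms(2) by (simp add: field_simps flip: 2)
qed

text \<open>The numerator of the integrand; it is what remains when the recurrence cancels the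
  denominator.\<close>

definition gamma_kernel :: "complex \<Rightarrow> complex \<Rightarrow> real \<Rightarrow> complex" where
  "gamma_kernel s v t = of_real t powr (s - 1) * exp (- v * of_real t)"

lemma norm_gamma_kernel:
  "t > 0 \<Longrightarrow> norm (gamma_kernel s v t) = t powr (Re s - 1) * exp (- (Re v * t))"
  by (simp add: gamma_kernel_def norm_mult norm_powr_real_powr)

lemma continuous_on_gamma_kernel: "continuous_on {0<..} (gamma_kernel s v)"
  unfolding gamma_kernel_def
  by (intro continuous_intros) (auto simp: complex_nonpos_Reals_iff)

lemma absolutely_integrable_gamma_kernel_real:
  assumes "Re s > 0" "x > 0"
  shows "gamma_kernel s (of_real x) absolutely_integrable_on {0<..}"
  using absolutely_integrable_Gamma_integral[OF assms]
  by (simp add: gamma_kernel_def[abs_def] exp_minus field_simps exp_of_real flip: of_real_mult)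

text \<open>Euler's integral for \<open>Gamma s\<close>, rescaled by \<open>x\<close>; since
  \<open>x\<close> and \<open>t\<close> are positive reals, the principal power of
  \<open>x * t\<close> splits.\<close>

lemma gamma_kernel_has_integral_real:
  assumes "Re s > 0" "x > 0"
  shows "(gamma_kernel s (of_real x) has_integral Gamma s * of_real x powr (- s)) {0<..}"
proof -
  let ?f = "\<lambda>t. complex_of_real t powr (s - 1) / of_real (exp t)"
  have i: "integral {0<..} ?f = Gamma s"
    using Gamma_integral_complex'[OF assms(1)] by (rule integral_unique)
  have eq: "gamma_kernel s (of_real x) t = ?f (x * t) * of_real x powr (1 - s)" if "t > 0" for t
  proof -
    have "complex_of_real (x * t) powr (s - 1) = of_real x powr (s - 1) * of_real t powr (s - 1)"
      using assms(2) that by (simp add: powr_times_real_left)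
    moreover have "complex_of_real x powr (s - 1) * of_real x powr (1 - s) = 1"
      using assms(2) by (simp flip: powr_add)
    ultimately show ?thesis
      by (simp add: gamma_kernel_def exp_minus field_simps exp_of_real flip: of_real_mult)
  qed
  note sc = absolutely_integrable_scale_Ioi[OF absolutely_integrable_Gamma_integral'[OF assms(1)] assms(2)]
  have "((\<lambda>t. ?f (x * t)) has_integral Gamma s /\<^sub>R x) {0<..}"
    using sc unfolding i by (metis (no_types, lifting) has_integral_iff set_lebesgue_integral_eq_integral(1))
  then have "((\<lambda>t. ?f (x * t) * of_real x powr (1 - s)) has_integral (Gamma s /\<^sub>R x) * of_real x powr (1 - s)) {0<..}"
    by (rule has_integral_mult_left)
  also have "(Gamma s /\<^sub>R x) * of_real x powr (1 - s) = Gamma s * of_real x powr (- s)"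
    using assms(2) by (simp add: powr_diff powr_minus scaleR_conv_of_real field_simps)
  finally show ?thesis
    by (rule has_integral_eq[rotated]) (use eq in auto)
qed

text \<open>
  Every \<open>v\<close> in the right half plane lies in a disc \<open>\<bar>v - x\<bar> < x\<close> with real \<open>x\<close>, so a single expansion
  of \<open>exp (- v t)\<close> about \<open>x\<close> suffices; integrated termwise, it becomes the binomial series of
  \<open>v powr (- s)\<close>.
\<close>

lemma gamma_kernel_has_integral:
  assumes "Re s > 0" "Re v > 0"
  shows "(gamma_kernel s v has_integral Gamma s * v powr (- s)) {0<..}"
proof -
  \<comment> \<open>With this choice \<open>x * Re v\<close> is the squared modulus of
    \<open>v\<close>, which gives |h|^2 = x^2 - |v|^2.\<close>
  define x where "x = (norm v)\<^sup>2 / Re v"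
  define h where "h = v - of_real x"
  have v0: "norm v > 0" using assms(2) by auto
  have x: "x > 0" using assms(2) v0 by (simp add: x_def)
  have "(norm h)\<^sup>2 = (norm v)\<^sup>2 - 2 * x * Re v + x\<^sup>2"
    unfolding h_def cmod_power2 by (simp add: power2_eq_square algebra_simps)
  also have "\<dots> = x\<^sup>2 - (norm v)\<^sup>2"
    using assms(2) by (simp add: x_def)
  also have "\<dots> < x\<^sup>2" using v0 by simp
  finally have hx: "norm h < x" using x by (simp add: power_less_imp_less_base)
  \<comment> \<open>Taylor polynomials of \<open>exp (- h * t)\<close> times the kernel at
    \<open>x\<close>; absorbing \<open>t ^ i\<close> into \<open>s\<close> makes each term a Gamma
    integral.\<close>
  define F where "F = (\<lambda>N t. \<Sum>i<N. (- h) ^ i / fact i * gamma_kernel (s + of_nat i) (of_real x) t)"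
  have shift: "gamma_kernel (s + of_nat i) w t = of_real t ^ i * gamma_kernel s w t" if "t > 0" for i w t
  proof -
    have "complex_of_real t powr (s + of_nat i - 1) = of_real t powr (s - 1) * of_real t powr of_nat i"
      by (simp flip: powr_add add: algebra_simps)
    with that show ?thesis by (simp add: gamma_kernel_def)
  qed
  have F: "F N t = (\<Sum>i<N. (- h * of_real t) ^ i / fact i) * gamma_kernel s (of_real x) t" if "t > 0" for N t
    unfolding F_def sum_distrib_right power_mult_distrib
    using that by (intro sum.cong) (simp_all add: shift)
  show ?thesis
  proof (rule has_integral_dominated_convergence)
    show "(F N has_integral (\<Sum>i<N. (- h) ^ i / fact i * (Gamma (s + of_nat i) * of_real x powr (- (s + of_nat i))))) {0<..}" for N
      unfolding F_def using assms x
      by (intro has_integral_sum has_integral_mult_right gamma_kernel_has_integral_real) auto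
    \<comment> \<open>The polynomials grow at most like \<open>exp (norm h * t)\<close>, and
      \<open>norm h < x\<close> leaves exponential decay.\<close>
    show "(\<lambda>t. norm (gamma_kernel s (of_real (x - norm h)) t)) integrable_on {0<..}"
      using absolutely_integrable_gamma_kernel_real[of s "x - norm h"] assms(1) hx
      by (simp add: absolutely_integrable_on_def)
    show "\<forall>t\<in>{0<..}. norm (F N t) \<le> norm (gamma_kernel s (of_real (x - norm h)) t)" for N
    proof
      fix t :: real assume "t \<in> {0<..}"
      then have t: "t > 0" by simp
      have "norm (\<Sum>i<N. (- h * of_real t) ^ i / fact i) \<le> (\<Sum>i<N. norm ((- h * of_real t) ^ i / fact i))"
        by (rule norm_sum)
      also have "\<dots> = (\<Sum>i<N. (norm h * t) ^ i /\<^sub>R fact i)"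
        using t by (simp add: norm_divide norm_power norm_mult divide_inverse norm_inverse mult.commute)
      also have "\<dots> \<le> exp (norm h * t)"
        unfolding exp_def using t
        by (intro sum_le_suminf summable_exp_generic) auto
      finally have "norm (F N t) \<le> exp (norm h * t) * norm (gamma_kernel s (of_real x) t)"
        using t by (simp add: F norm_mult mult_right_mono)
      also have "\<dots> = norm (gamma_kernel s (of_real (x - norm h)) t)"
        using t by (simp add: norm_gamma_kernel algebra_simps flip: exp_add)
      finally show "norm (F N t) \<le> norm (gamma_kernel s (of_real (x - norm h)) t)" .
    qed
    show "\<forall>t\<in>{0<..}. (\<lambda>N. F N t) \<longlonglongrightarrow> gamma_kernel s v t"
    proof
      fix t :: real assume "t \<in> {0<..}"
      then have t: "t > 0" by simp
      have "(\<lambda>N. \<Sum>i<N. (- h * of_real t) ^ i / fact i) \<longlonglongrightarrow> exp (- h * of_real t)"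
        using exp_converges[of "- h * of_real t"] by (simp add: sums_def scaleR_conv_of_real divide_inverse mult.commute)
      then have "(\<lambda>N. F N t) \<longlonglongrightarrow> exp (- h * of_real t) * gamma_kernel s (of_real x) t"
        unfolding F[OF t] by (rule tendsto_mult_right)
      also have "exp (- h * of_real t) * gamma_kernel s (of_real x) t = gamma_kernel s v t"
        by (simp add: gamma_kernel_def h_def algebra_simps flip: exp_add)
      finally show "(\<lambda>N. F N t) \<longlonglongrightarrow> gamma_kernel s v t" .
    qed
    have s: "s \<notin> \<int>\<^sub>\<le>\<^sub>0" using assms(1) by (auto elim!: nonpos_Ints_cases)
    then have G: "Gamma s \<noteq> 0" by (simp add: Gamma_eq_zero_iff)
    \<comment> \<open>The quotient \<open>Gamma (s + i) / Gamma s\<close> is a Pochhammer symbol, so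
      binomial coefficients of exponent \<open>- s\<close> appear.\<close>
    have coeff: "(- h) ^ i / fact i * (Gamma (s + of_nat i) * of_real x powr (- (s + of_nat i)))
          = Gamma s * of_real x powr (- s) * ((- s gchoose i) * (h / of_real x) ^ i)" for i
    proof -
      have "Gamma (s + of_nat i) = pochhammer s i * Gamma s"
        using pochhammer_Gamma[OF s, of i] G by simp
      moreover have "complex_of_real x powr (- (s + of_nat i)) = of_real x powr (- s) / of_real x ^ i"
        using x powr_diff[of "complex_of_real x" "- s" "of_nat i"] by simp
      ultimately show ?thesis
        by (simp add: gbinomial_pochhammer power_minus[of h] power_divide field_simps)
    qed
    have hx1: "norm (h / of_real x) < 1" using hx x by (simp add: norm_divide)
    have lim: "(\<lambda>N. \<Sum>i<N. (- h) ^ i / fact i * (Gamma (s + of_nat i) * of_real x powr (- (s + of_nat i))))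
        \<longlonglongrightarrow> Gamma s * of_real x powr (- s) * (1 + h / of_real x) powr (- s)"
      using sums_mult[OF gen_binomial_complex[OF hx1], of "Gamma s * of_real x powr (- s)" "- s"]
      by (simp only: coeff sums_def)
    have "of_real x * (1 + h / of_real x) = v"
      using x by (simp add: h_def field_simps)
    moreover have "(of_real x * (1 + h / of_real x)) powr (- s) = of_real x powr (- s) * (1 + h / of_real x) powr (- s)"
      using x by (intro powr_times_real_left) auto
    ultimately have "Gamma s * v powr (- s) = Gamma s * of_real x powr (- s) * (1 + h / of_real x) powr (- s)"
      by simp
    with lim show "(\<lambda>N. \<Sum>i<N. (- h) ^ i / fact i * (Gamma (s + of_nat i) * of_real x powr (- (s + of_nat i))))
        \<longlonglongrightarrow> Gamma s * v powr (- s)"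
      by (simp only:)
  qed
qed

subsection \<open>Recurrences for the integral and the series\<close>

definition lerch_kernel :: "complex \<Rightarrow> complex \<Rightarrow> complex \<Rightarrow> real \<Rightarrow> complex" where
  "lerch_kernel z s v t = gamma_kernel s v t / (1 - z * exp (- of_real t))"

text \<open>The endpoint 0 is negligible; without it all estimates may assume \<open>t > 0\<close>,
  where the denominator is nonzero for \<open>norm z \<le> 1\<close>.\<close>

lemma lerch_integral_eq:
  "lerch_integral z s v = integral {0<..} (lerch_kernel z s v) / Gamma s"
proof -
  have "integral {0..} (lerch_kernel z s v) = integral {0<..} (lerch_kernel z s v)"
  proof (rule integral_spike_set)
    show "negligible {t \<in> {0..} - {0<..}. lerch_kernel z s v t \<noteq> 0}"
      by (rule negligible_subset[of "{0}"]) auto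
    show "negligible {t \<in> {0<..} - {0..}. lerch_kernel z s v t \<noteq> 0}"
      by (rule negligible_subset[of "{}"]) auto
  qed
  then show ?thesis
    by (simp add: lerch_integral_def lerch_kernel_def[abs_def] gamma_kernel_def)
qed

text \<open>The reverse triangle inequality; every estimate of the denominator below rests on
  it.\<close>

lemma one_minus_exp_le_norm:
  assumes "norm z \<le> 1"
  shows "1 - exp (- t) \<le> norm (1 - z * exp (- complex_of_real t))"
proof -
  have "norm (z * exp (- complex_of_real t)) \<le> exp (- t)"
    using assms by (simp add: norm_mult)
  moreover have "norm (1::complex) - norm (z * exp (- complex_of_real t)) \<le> norm (1 - z * exp (- complex_of_real t))"
    by (rule norm_triangle_ineq2)
  ultimately show ?thesis by simp
qed

lemma lerch_denominator_nonzero: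
  assumes "norm z \<le> 1" "t > 0"
  shows "1 - z * exp (- complex_of_real t) \<noteq> 0"
proof -
  have "0 < 1 - exp (- t)" using assms(2) by simp
  also have "\<dots> \<le> norm (1 - z * exp (- complex_of_real t))"
    by (rule one_minus_exp_le_norm) fact
  finally show ?thesis by auto
qed

text \<open>For \<open>z \<noteq> 1\<close> the denominator stays away from 0. For
  \<open>Re s > 1\<close> it may vanish like \<open>t\<close> at 0, which costs one power of
  \<open>t\<close> and leaves the integral convergent.\<close>

lemma absolutely_integrable_lerch_kernel:
  assumes "norm z \<le> 1" and "z \<noteq> 1 \<and> Re s > 0 \<or> Re s > 1" and "Re v > 0"
  shows "lerch_kernel z s v absolutely_integrable_on {0<..}"
proof -
  have meas: "lerch_kernel z s v \<in> borel_measurable (lebesgue_on {0<..})"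
    unfolding lerch_kernel_def using assms(1)
    by (intro continuous_imp_measurable_on_sets_lebesgue continuous_on_divide
          continuous_on_gamma_kernel ballI lerch_denominator_nonzero continuous_intros) auto
  have int: "(\<lambda>t. t powr (Re w - 1) * exp (- (Re v * t))) integrable_on {0<..}" if "Re w > 0" for w
  proof -
    have "(\<lambda>t. norm (gamma_kernel w (of_real (Re v)) t)) integrable_on {0<..}"
      using absolutely_integrable_gamma_kernel_real[OF that assms(3)]
      by (simp add: absolutely_integrable_on_def)
    then show ?thesis
      by (rule integrable_eq) (simp add: norm_gamma_kernel)
  qed
  have norm_kernel: "norm (lerch_kernel z s v t) =
      t powr (Re s - 1) * exp (- (Re v * t)) * inverse (norm (1 - z * exp (- complex_of_real t)))"
    if "t > 0" for t
    using that by (simp add: lerch_kernel_def norm_divide norm_gamma_kernel divide_inverse norm_mult norm_inverse)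
  have "\<exists>g. g integrable_on {0<..} \<and> (\<forall>t\<in>{0<..}. norm (lerch_kernel z s v t) \<le> g t)"
    using assms(2)
  proof
    assume z: "z \<noteq> 1 \<and> Re s > 0"
    show ?thesis
    proof (intro exI conjI ballI)
      show "(\<lambda>t. t powr (Re s - 1) * exp (- (Re v * t)) * (2 / norm (1 - z))) integrable_on {0<..}"
        using int z by (intro integrable_on_mult_left) auto
      fix t :: real assume "t \<in> {0<..}"
      then have t: "t > 0" by simp
      \<comment> \<open>The denominator differs from \<open>1 - z\<close> by at most its own
        modulus, so that modulus is at least half of \<open>norm (1 - z)\<close>.\<close>
      have "norm (z * exp (- complex_of_real t) - z) = norm z * (1 - exp (- t))"
      proof -
        have "z * exp (- complex_of_real t) - z = - z * of_real (1 - exp (- t))"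
          by (simp add: algebra_simps exp_of_real flip: of_real_minus)
        then show ?thesis using t by (simp add: norm_mult del: of_real_diff)
      qed
      also have "\<dots> \<le> 1 - exp (- t)"
        using assms(1) t by (intro mult_left_le_one_le) auto
      also have "\<dots> \<le> norm (1 - z * exp (- complex_of_real t))"
        by (rule one_minus_exp_le_norm) fact
      finally have "norm (1 - z) \<le> 2 * norm (1 - z * exp (- complex_of_real t))"
        using norm_triangle_ineq[of "1 - z * exp (- complex_of_real t)" "z * exp (- complex_of_real t) - z"]
        by simp
      then have "inverse (norm (1 - z * exp (- complex_of_real t))) \<le> 2 / norm (1 - z)"
        using z lerch_denominator_nonzero[OF assms(1) t] by (simp add: field_simps)
      then show "norm (lerch_kernel z s v t) \<le> t powr (Re s - 1) * exp (- (Re v * t)) * (2 / norm (1 - z))"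
        unfolding norm_kernel[OF t] by (intro mult_left_mono) auto
    qed
  next
    assume s: "Re s > 1"
    show ?thesis
    proof (intro exI conjI ballI)
      show "(\<lambda>t. t powr (Re s - 1) * exp (- (Re v * t)) + t powr (Re (s - 1) - 1) * exp (- (Re v * t)))
          integrable_on {0<..}"
        using int[of s] int[of "s - 1"] s by (intro integrable_add) auto
      fix t :: real assume "t \<in> {0<..}"
      then have t: "t > 0" by simp
      \<comment> \<open>Since \<open>exp t \<ge> 1 + t\<close>, the denominator is at least
        \<open>t / (1 + t)\<close>, whose inverse \<open>1 + 1 / t\<close> yields the two summands
        of the majorant.\<close>
      have "exp t * exp (- t) = 1" by (simp flip: exp_add)
      then have "(1 + t) * exp (- t) \<le> 1"
        using exp_ge_add_one_self[of t] by (metis exp_ge_zero mult_right_mono)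
      then have "t / (1 + t) \<le> 1 - exp (- t)"
        using t by (simp add: field_simps)
      also have "\<dots> \<le> norm (1 - z * exp (- complex_of_real t))"
        by (rule one_minus_exp_le_norm) fact
      finally have "inverse (norm (1 - z * exp (- complex_of_real t))) \<le> inverse (t / (1 + t))"
        using t by (intro le_imp_inverse_le) auto
      then have "norm (lerch_kernel z s v t) \<le> t powr (Re s - 1) * exp (- (Re v * t)) * inverse (t / (1 + t))"
        unfolding norm_kernel[OF t] by (intro mult_left_mono) auto
      also have "\<dots> = t powr (Re s - 1) * exp (- (Re v * t)) + t powr (Re (s - 1) - 1) * exp (- (Re v * t))"
      proof -
        have "t powr (Re s - 1) = t * t powr (Re (s - 1) - 1)"
          using t powr_add[of t 1 "Re (s - 1) - 1"] by simp
        then show ?thesis using t by (simp add: field_simps)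
      qed
      finally show "norm (lerch_kernel z s v t) \<le>
          t powr (Re s - 1) * exp (- (Re v * t)) + t powr (Re (s - 1) - 1) * exp (- (Re v * t))" .
    qed
  qed
  then show ?thesis
    using meas measurable_bounded_by_integrable_imp_absolutely_integrable[of "lerch_kernel z s v" "{0<..}"]
    by auto
qed

text \<open>Passing to \<open>v + 1\<close> multiplies the integrand by \<open>exp (- t)\<close>;
  the difference cancels the denominator and leaves a Laplace transform.\<close>

lemma lerch_integral_rec:
  assumes "norm z \<le> 1" and "z \<noteq> 1 \<and> Re s > 0 \<or> Re s > 1" and "Re v > 0"
  shows "lerch_integral z s v = v powr (- s) + z * lerch_integral z s (v + 1)"
proof -
  have int: "lerch_kernel z s w integrable_on {0<..}" if "Re w > 0" for w
    using absolutely_integrable_lerch_kernel[OF assms(1,2) that] by (simp add: absolutely_integrable_on_def)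
  have s: "Re s > 0" using assms(2) by auto
  have "Gamma s * v powr (- s) = integral {0<..} (gamma_kernel s v)"
    using gamma_kernel_has_integral[OF s assms(3)] by (simp add: integral_unique)
  also have "\<dots> = integral {0<..} (\<lambda>t. lerch_kernel z s v t - z * lerch_kernel z s (v + 1) t)"
  proof (rule integral_cong)
    fix t :: real assume t: "t \<in> {0<..}"
    define e where "e = exp (- complex_of_real t)"
    have e: "gamma_kernel s (v + 1) t = gamma_kernel s v t * e"
      by (simp add: gamma_kernel_def e_def algebra_simps flip: exp_add)
    have d: "1 - z * e \<noteq> 0"
      unfolding e_def using t assms(1) by (intro lerch_denominator_nonzero) auto
    have "lerch_kernel z s v t - z * lerch_kernel z s (v + 1) t = gamma_kernel s v t * (1 - z * e) / (1 - z * e)"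
      unfolding lerch_kernel_def e_def[symmetric] e
      by (simp only: times_divide_eq_right flip: diff_divide_distrib) (simp add: algebra_simps)
    with d show "gamma_kernel s v t = lerch_kernel z s v t - z * lerch_kernel z s (v + 1) t"
      by simp
  qed
  also have "\<dots> = integral {0<..} (lerch_kernel z s v) - z * integral {0<..} (lerch_kernel z s (v + 1))"
    using int assms(3) by (subst integral_diff) (auto intro: integrable_on_mult_right)
  finally have "Gamma s * v powr (- s) =
      integral {0<..} (lerch_kernel z s v) - z * integral {0<..} (lerch_kernel z s (v + 1))" .
  moreover have "Gamma s \<noteq> 0"
    using s by (auto simp: Gamma_eq_zero_iff elim!: nonpos_Ints_cases)
  ultimately show ?thesis
    unfolding lerch_integral_eq by (simp add: field_simps)
qed

section \<open>Convergence and recurrence of the series\<close>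

text \<open>Polynomial growth against geometric decay; a complex \<open>s\<close> adds only the
  bounded factor \<open>C\<close> from the argument of the base.\<close>

lemma summable_lerch_series:
  fixes z s v :: complex
  assumes "norm z < 1"
  shows "summable (\<lambda>r. (v + of_nat r) powr (- s) * z ^ r)"
proof (rule summable_comparison_test_ev)
  define K where "K = nat \<lceil>\<bar>Re s\<bar>\<rceil>"
  define C where "C = exp (\<bar>Im s\<bar> * pi)"
  have "conv_radius (\<lambda>r. real (Suc r) ^ K) = ereal 1"
  proof (rule conv_radius_ratio_limit_nonzero)
    have "(\<lambda>r. (real (Suc r) / real (Suc (Suc r))) ^ K) \<longlonglongrightarrow> 1 ^ K"
      by (intro tendsto_power LIMSEQ_Suc[OF LIMSEQ_n_over_Suc_n])
    then show "(\<lambda>r. norm (real (Suc r) ^ K) / norm (real (Suc (Suc r)) ^ K)) \<longlonglongrightarrow> 1"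
      by (simp add: power_divide norm_power)
  qed auto
  then have "summable (\<lambda>r. real (Suc r) ^ K * norm z ^ r)"
    using assms by (intro summable_in_conv_radius) simp
  then show "summable (\<lambda>r. C * 2 ^ K * (real (Suc r) ^ K * norm z ^ r))"
    by (rule summable_mult)
  have "norm ((v + of_nat r) powr (- s) * z ^ r) \<le> C * 2 ^ K * (real (Suc r) ^ K * norm z ^ r)"
    if r: "real r \<ge> norm v + 1" for r
  proof -
    \<comment> \<open>From this index on the base has modulus between 1 and \<open>2 * r\<close>;
      the lower bound makes powers monotone in the exponent.\<close>
    have lo: "1 \<le> norm (v + of_nat r)"
      using r norm_triangle_ineq4[of "v + of_nat r" v] by simp
    have hi: "norm (v + of_nat r) \<le> 2 * real r"
      using r norm_triangle_ineq[of v "of_nat r"] by simp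
    have "norm (v + of_nat r) powr (- Re s) \<le> norm (v + of_nat r) powr real K"
      using lo by (intro powr_mono) (auto simp: K_def, linarith)
    also have "\<dots> = norm (v + of_nat r) ^ K"
      using lo by (intro powr_realpow) auto
    also have "\<dots> \<le> (2 * real (Suc r)) ^ K"
      using hi by (intro power_mono) auto
    finally have 1: "norm (v + of_nat r) powr (- Re s) \<le> (2 * real (Suc r)) ^ K" .
    have "Im s * Arg (v + of_nat r) \<le> \<bar>Im s\<bar> * \<bar>Arg (v + of_nat r)\<bar>"
      by (metis abs_ge_self abs_mult)
    also have "\<dots> \<le> \<bar>Im s\<bar> * pi"
      using Arg_bounded[of "v + of_nat r"] by (intro mult_left_mono) auto
    finally have 2: "exp (Im s * Arg (v + of_nat r)) \<le> C" by (simp add: C_def)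
    have "norm ((v + of_nat r) powr (- s)) \<le> (2 * real (Suc r)) ^ K * C"
      unfolding norm_powr_complex using 1 2 by (intro mult_mono) auto
    from mult_right_mono[OF this, of "norm z ^ r"] show ?thesis
      by (simp add: norm_mult norm_power mult_ac flip: power_mult_distrib)
  qed
  then show "eventually (\<lambda>r. norm ((v + of_nat r) powr (- s) * z ^ r) \<le> C * 2 ^ K * (real (Suc r) ^ K * norm z ^ r)) sequentially"
    by (intro eventually_sequentiallyI[of "nat \<lceil>norm v + 1\<rceil>"])
       (simp only: nat_le_iff ceiling_le_iff of_int_of_nat_eq)
qed

lemma lerch_series_rec:
  assumes "norm z < 1"
  shows "lerch_series z s v = v powr (- s) + z * lerch_series z s (v + 1)"
proof -
  note sm = summable_lerch_series[OF assms]
  have "lerch_series z s v = v powr (- s) + (\<Sum>r. (v + of_nat (Suc r)) powr (- s) * z ^ Suc r)"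
    unfolding lerch_series_def using suminf_split_head[OF sm[of v s]] by simp
  also have "(\<Sum>r. (v + of_nat (Suc r)) powr (- s) * z ^ Suc r) =
             (\<Sum>r. z * ((v + 1 + of_nat r) powr (- s) * z ^ r))"
    by (simp add: add_ac mult_ac)
  also have "\<dots> = z * lerch_series z s (v + 1)"
    unfolding lerch_series_def by (rule suminf_mult[OF sm])
  finally show ?thesis .
qed

section \<open>A common form of series and integral\<close>

text \<open>The condition of \<open>lerch_defined\<close> on \<open>z\<close> and \<open>s\<close>,
  regrouped to fit the hypotheses on the integral.\<close>

definition lerch_admissible :: "complex \<Rightarrow> complex \<Rightarrow> bool" where
  "lerch_admissible z s \<longleftrightarrow>
     norm z < 1 \<or> norm z \<le> 1 \<and> (z \<noteq> 1 \<and> Re s > 0 \<or> Re s > 1)"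

text \<open>One name for both representations, used beyond a finite initial segment, where
  \<open>Re v > 0\<close>.\<close>

definition lerch_tail :: "complex \<Rightarrow> complex \<Rightarrow> complex \<Rightarrow> complex" where
  "lerch_tail z s v = (if norm z < 1 then lerch_series z s v else lerch_integral z s v)"

lemma lerch_tail_rec:
  assumes "lerch_admissible z s" and "Re v > 0"
  shows "lerch_tail z s v = v powr (- s) + z * lerch_tail z s (v + 1)"
proof (cases "norm z < 1")
  case True
  then show ?thesis by (simp only: lerch_tail_def if_True lerch_series_rec[of z s v])
next
  case False
  with assms have "lerch_integral z s v = v powr (- s) + z * lerch_integral z s (v + 1)"
    by (intro lerch_integral_rec) (auto simp: lerch_admissible_def)
  with False show ?thesis by (simp only: lerch_tail_def if_False)
qed

text \<open>The recurrence moves one term at a time across the cut, so the least index in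
  \<open>lerch_phi\<close> can be replaced by any later one and different arguments can share a
  cut.\<close>

lemma lerch_phi_expand:
  assumes "lerch_admissible z s" and "Re (v + of_nat N) > 0"
  shows "lerch_phi z s v = (\<Sum>r<N. (v + of_nat r) powr (- s) * z ^ r) + z ^ N * lerch_tail z s (v + of_nat N)"
proof (cases "norm z < 1")
  case True
  have "lerch_series z s v = (\<Sum>r<N. (v + of_nat r) powr (- s) * z ^ r) + z ^ N * lerch_series z s (v + of_nat N)"
  proof (induction N)
    case (Suc N)
    with lerch_series_rec[OF True, of s "v + of_nat N"] show ?case by (simp add: algebra_simps)
  qed simp
  with True show ?thesis by (simp add: lerch_phi_def lerch_tail_def)
next
  case False
  define L where "L = (LEAST N::nat. Re v + real N > 0)"
  have L: "Re v + real L > 0" "L \<le> N"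
    unfolding L_def using assms(2) by (auto intro: LeastI[of _ N] Least_le)
  from L(2) show ?thesis
  proof (induction N rule: dec_induct)
    case base
    from False show ?case by (simp add: lerch_phi_def Let_def lerch_tail_def flip: L_def)
  next
    case (step N)
    have "Re (v + of_nat N) > 0" using L(1) step.hyps by simp
    from lerch_tail_rec[OF assms(1) this] step.IH show ?case
      by (simp add: algebra_simps)
  qed
qed

text \<open>Cutting the left side at \<open>Suc N\<close> and the right side at \<open>N\<close>
  leaves the same tail, wherever \<open>v\<close> lies.\<close>

lemma lerch_phi_rec:
  assumes "lerch_admissible z s"
  shows "lerch_phi z s v = v powr (- s) + z * lerch_phi z s (v + 1)"
proof -
  obtain N :: nat where "- Re v < real N" using reals_Archimedean2 by blast
  then have N: "Re (v + of_nat (Suc N)) > 0" "Re (v + 1 + of_nat N) > 0" by auto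
  show ?thesis
    unfolding lerch_phi_expand[OF assms N(1)] lerch_phi_expand[OF assms N(2)]
    by (simp add: sum.lessThan_Suc_shift sum_distrib_left algebra_simps del: sum.lessThan_Suc)
qed

subsection \<open>The multiplication formula\<close>

text \<open>A geometric sum whose ratio \<open>\<zeta> powi r\<close> is an \<open>n\<close>-th root
  of unity. Integer exponents serve the sum that starts at \<open>- j\<close>.\<close>

lemma sum_root_of_unity_powi:
  fixes q \<zeta> :: complex
  assumes "n > 0" and prim: "\<And>r. \<zeta> powi r = 1 \<longleftrightarrow> int n dvd r"
  shows "(\<Sum>p<n. (q * \<zeta> ^ p) powi r) = (if int n dvd r then of_nat n * q powi r else 0)"
proof -
  have "(\<Sum>p<n. (q * \<zeta> ^ p) powi r) = q powi r * (\<Sum>p<n. (\<zeta> powi r) ^ p)"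
    by (simp add: sum_distrib_left power_int_mult_distrib power_int_power power_int_power' mult.commute)
  moreover have "(\<Sum>p<n. (\<zeta> powi r) ^ p) = 0" if "\<not> int n dvd r"
  proof -
    have "(\<zeta> powi r) ^ n = \<zeta> powi (r * int n)"
      by (simp add: power_int_power')
    then have "(\<zeta> powi r) ^ n = 1"
      by (simp add: prim)
    moreover have "\<zeta> powi r \<noteq> 1"
      using that by (simp add: prim)
    ultimately show ?thesis by (simp add: geometric_sum)
  qed
  moreover have "\<zeta> powi r = 1" if "int n dvd r"
    using that by (simp add: prim)
  ultimately show ?thesis by auto
qed

lemma sum_root_of_unity_power:
  fixes q \<zeta> :: complex
  assumes "n > 0" and prim: "\<And>r. \<zeta> powi r = 1 \<longleftrightarrow> int n dvd r"
  shows "(\<Sum>p<n. (q * \<zeta> ^ p) ^ r) = (if n dvd r then of_nat n * q ^ r else 0)"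
  using sum_root_of_unity_powi[OF assms, of q "int r"] by simp

lemma
  fixes q \<zeta> :: complex
  assumes "n > 0" and prim: "\<And>r. \<zeta> powi r = 1 \<longleftrightarrow> int n dvd r"
  shows root_of_unity_power: "(q * \<zeta> ^ p) ^ n = q ^ n"
    and norm_root_of_unity: "norm (q * \<zeta> ^ p) = norm q"
proof -
  have z: "\<zeta> ^ n = 1" using prim[of "int n"] by simp
  then have "(\<zeta> ^ p) ^ n = 1"
    by (metis mult.commute power_mult power_one)
  then show "(q * \<zeta> ^ p) ^ n = q ^ n" by (simp add: power_mult_distrib)
  have "norm \<zeta> = 1" using z assms(1) power_eq_1_iff by blast
  then show "norm (q * \<zeta> ^ p) = norm q" by (simp add: norm_mult norm_power)
qed

text \<open>The filter leaves \<open>r = n * t\<close>, where the positive factor \<open>n\<close>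
  comes out of the power of \<open>n * (v + t)\<close>.\<close>

lemma lerch_series_multiplication:
  fixes q \<zeta> s v :: complex
  assumes "n > 0" and prim: "\<And>r. \<zeta> powi r = 1 \<longleftrightarrow> int n dvd r" and "norm q < 1"
  shows "(\<Sum>p<n. lerch_series (q * \<zeta> ^ p) s (of_nat n * v)) =
         of_nat n powr (1 - s) * lerch_series (q ^ n) s v"
proof -
  define f where "f = (\<lambda>r. (of_nat n * v + of_nat r) powr (- s) * (\<Sum>p<n. (q * \<zeta> ^ p) ^ r))"
  have "(\<Sum>p<n. lerch_series (q * \<zeta> ^ p) s (of_nat n * v)) =
        (\<Sum>r. \<Sum>p<n. (of_nat n * v + of_nat r) powr (- s) * (q * \<zeta> ^ p) ^ r)"
    unfolding lerch_series_def
    by (intro suminf_sum[symmetric] summable_lerch_series)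
       (simp add: norm_root_of_unity[OF assms(1) prim] assms(3))
  also have "\<dots> = suminf f"
    by (simp add: f_def sum_distrib_left)
  also have "\<dots> = (\<Sum>t. f (n * t))"
    by (intro suminf_mono_reindex[symmetric])
       (use assms(1) in \<open>auto simp: f_def sum_root_of_unity_power[OF assms(1) prim] strict_mono_def image_iff elim!: dvdE\<close>)
  also have "\<dots> = (\<Sum>t. of_nat n powr (1 - s) * ((v + of_nat t) powr (- s) * (q ^ n) ^ t))"
  proof (rule suminf_cong)
    fix t
    have "f (n * t) = (of_nat n * v + of_nat (n * t)) powr (- s) * (of_nat n * q ^ (n * t))"
      unfolding f_def sum_root_of_unity_power[OF assms(1) prim] by simp
    moreover have "of_nat n * v + of_nat (n * t) = of_nat n * (v + of_nat t)"
      by (simp add: algebra_simps)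
    moreover have "(of_nat n * (v + of_nat t)) powr (- s) = of_nat n powr (- s) * (v + of_nat t) powr (- s)"
      by (rule powr_times_real_left) auto
    ultimately show "f (n * t) = of_nat n powr (1 - s) * ((v + of_nat t) powr (- s) * (q ^ n) ^ t)"
      using assms(1)
      by (simp add: powr_diff powr_minus power_mult field_simps)
  qed
  also have "\<dots> = of_nat n powr (1 - s) * lerch_series (q ^ n) s v"
    unfolding lerch_series_def
    by (intro suminf_mult summable_lerch_series) (use assms in \<open>simp add: norm_power power_less_one_iff\<close>)
  finally show ?thesis .
qed

text \<open>Each summand is a geometric sum of length \<open>n\<close> over
  \<open>1 - w ^ n\<close>; among exponents below \<open>n\<close>, only 0 survives the sum over
  \<open>p\<close>.\<close>

lemma sum_inverse_one_minus_root_of_unity: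
  fixes w \<zeta> :: complex
  assumes "n > 0" and prim: "\<And>r. \<zeta> powi r = 1 \<longleftrightarrow> int n dvd r" and "w ^ n \<noteq> 1"
  shows "(\<Sum>p<n. 1 / (1 - w * \<zeta> ^ p)) = of_nat n / (1 - w ^ n)"
proof -
  have "1 / (1 - w * \<zeta> ^ p) = (\<Sum>r<n. (w * \<zeta> ^ p) ^ r) / (1 - w ^ n)" for p
  proof -
    have *: "1 - w ^ n = (1 - w * \<zeta> ^ p) * (\<Sum>r<n. (w * \<zeta> ^ p) ^ r)"
      using one_diff_power_eq[of "w * \<zeta> ^ p" n] unfolding root_of_unity_power[OF assms(1) prim] .
    have "(1 - w * \<zeta> ^ p) * (\<Sum>r<n. (w * \<zeta> ^ p) ^ r) \<noteq> 0"
      unfolding *[symmetric] using assms(3) by simp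
    moreover have "1 / x = y / (x * y)" if "x * y \<noteq> 0" for x y :: complex
      using that by simp
    ultimately show ?thesis unfolding * by blast
  qed
  then have "(\<Sum>p<n. 1 / (1 - w * \<zeta> ^ p)) = (\<Sum>p<n. \<Sum>r<n. (w * \<zeta> ^ p) ^ r) / (1 - w ^ n)"
    by (simp add: sum_divide_distrib)
  also have "(\<Sum>p<n. \<Sum>r<n. (w * \<zeta> ^ p) ^ r) = (\<Sum>r<n. if n dvd r then of_nat n * w ^ r else 0)"
    by (subst sum.swap) (simp add: sum_root_of_unity_power[OF assms(1) prim])
  also have "\<dots> = (\<Sum>r<n. if r = 0 then of_nat n else 0)"
    by (intro sum.cong) (auto dest: nat_dvd_not_less)
  also have "\<dots> = of_nat n"
    using assms(1) by simp
  finally show ?thesis .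
qed

text \<open>Partial fractions at \<open>w = q * exp (- t)\<close> produce the kernel for
  \<open>q ^ n\<close> at \<open>n * t\<close>; rescaling cancels the extra factor
  \<open>n\<close>.\<close>

lemma lerch_integral_multiplication:
  fixes q \<zeta> s v :: complex
  assumes "n > 0" and prim: "\<And>r. \<zeta> powi r = 1 \<longleftrightarrow> int n dvd r"
    and q: "norm q \<le> 1" and s: "q ^ n \<noteq> 1 \<and> Re s > 0 \<or> Re s > 1" and v: "Re v > 0"
  shows "(\<Sum>p<n. lerch_integral (q * \<zeta> ^ p) s (of_nat n * v)) =
         of_nat n powr (1 - s) * lerch_integral (q ^ n) s v"
proof -
  let ?K = "lerch_kernel (q ^ n) s v"
  have sp: "q * \<zeta> ^ p \<noteq> 1 \<and> Re s > 0 \<or> Re s > 1" for p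
    using s root_of_unity_power[OF assms(1) prim, of q p] by auto
  have qn: "norm (q ^ n) \<le> 1" using q by (simp add: norm_power power_le_one)
  have int: "lerch_kernel (q * \<zeta> ^ p) s (of_nat n * v) integrable_on {0<..}" for p
    using absolutely_integrable_lerch_kernel[OF _ sp[of p], of "of_nat n * v"] assms(1) q v
    by (simp add: absolutely_integrable_on_def norm_root_of_unity[OF assms(1) prim])
  have "(\<Sum>p<n. integral {0<..} (lerch_kernel (q * \<zeta> ^ p) s (of_nat n * v))) =
        integral {0<..} (\<lambda>t. \<Sum>p<n. lerch_kernel (q * \<zeta> ^ p) s (of_nat n * v) t)"
    using int by (intro integral_sum[symmetric]) auto
  also have "\<dots> = integral {0<..} (\<lambda>t. of_nat n * of_nat n powr (1 - s) * ?K (real n * t))"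
  proof (rule integral_cong)
    fix t :: real assume "t \<in> {0<..}"
    then have t: "t > 0" by simp
    define e where "e = exp (- complex_of_real t)"
    have en: "exp (- complex_of_real (real n * t)) = e ^ n"
      by (simp add: e_def flip: exp_of_nat_mult)
    have "(q * e) ^ n \<noteq> 1"
      using lerch_denominator_nonzero[OF qn, of "real n * t"] t assms(1)
      unfolding en by (simp add: power_mult_distrib)
    note inv = sum_inverse_one_minus_root_of_unity[OF assms(1) prim this]
    have "lerch_kernel (q * \<zeta> ^ p) s (of_nat n * v) t =
        gamma_kernel s (of_nat n * v) t * (1 / (1 - q * e * \<zeta> ^ p))" for p
      by (simp add: lerch_kernel_def e_def mult_ac)
    then have "(\<Sum>p<n. lerch_kernel (q * \<zeta> ^ p) s (of_nat n * v) t) =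
        gamma_kernel s (of_nat n * v) t * (of_nat n / (1 - (q * e) ^ n))"
      by (simp only: inv flip: sum_distrib_left)
    moreover have "gamma_kernel s v (real n * t) * of_nat n powr (1 - s) = gamma_kernel s (of_nat n * v) t"
    proof -
      have "(of_nat n * complex_of_real t) powr (s - 1) = of_nat n powr (s - 1) * of_real t powr (s - 1)"
        by (rule powr_times_real_left) auto
      moreover have "complex_of_nat n powr (s - 1) * of_nat n powr (1 - s) = 1"
        using assms(1) by (simp flip: powr_add)
      ultimately show ?thesis by (simp add: gamma_kernel_def mult_ac)
    qed
    ultimately show "(\<Sum>p<n. lerch_kernel (q * \<zeta> ^ p) s (of_nat n * v) t) =
        of_nat n * of_nat n powr (1 - s) * ?K (real n * t)"
      unfolding lerch_kernel_def en by (simp add: power_mult_distrib mult_ac)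
  qed
  also have "\<dots> = of_nat n * of_nat n powr (1 - s) * (integral {0<..} ?K /\<^sub>R real n)"
    using absolutely_integrable_scale_Ioi(2)[OF absolutely_integrable_lerch_kernel[OF qn s v], of "real n"] assms(1)
    by simp
  also have "\<dots> = of_nat n powr (1 - s) * integral {0<..} ?K"
    using assms(1) by (simp add: scaleR_conv_of_real)
  finally show ?thesis
    unfolding lerch_integral_eq by (simp flip: sum_divide_distrib)
qed

text \<open>All \<open>q * \<zeta> ^ p\<close> have the modulus of \<open>q\<close>, and one of them
  can be 1 only if \<open>q ^ n = 1\<close>.\<close>

lemma lerch_admissible_root:
  fixes q \<zeta> :: complex
  assumes "n > 0" and prim: "\<And>r. \<zeta> powi r = 1 \<longleftrightarrow> int n dvd r" and "lerch_admissible (q ^ n) s"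
  shows "lerch_admissible (q * \<zeta> ^ p) s"
  using assms(3) root_of_unity_power[OF assms(1) prim, of q p] assms(1)
  unfolding lerch_admissible_def norm_root_of_unity[OF assms(1) prim]
  by (auto simp: norm_power power_less_one_iff power_le_one_iff)

text \<open>Equal moduli put all summands into the same case of \<open>lerch_tail\<close>, and
  \<open>norm q < 1\<close> is equivalent to \<open>norm (q ^ n) < 1\<close>.\<close>

lemma lerch_tail_multiplication:
  fixes q \<zeta> s v :: complex
  assumes "n > 0" and prim: "\<And>r. \<zeta> powi r = 1 \<longleftrightarrow> int n dvd r"
    and "lerch_admissible (q ^ n) s" and "Re v > 0"
  shows "(\<Sum>p<n. lerch_tail (q * \<zeta> ^ p) s (of_nat n * v)) =
         of_nat n powr (1 - s) * lerch_tail (q ^ n) s v"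
  unfolding lerch_tail_def norm_root_of_unity[OF assms(1) prim]
  using lerch_series_multiplication[OF assms(1) prim] lerch_integral_multiplication[OF assms(1) prim _ _ assms(4)] assms(1,3)
  by (auto simp: lerch_admissible_def norm_power power_less_one_iff power_le_one_iff)

text \<open>The factor \<open>z powi i\<close> makes the index absolute: \<open>i\<close> remains
  only as the lower limit, and the tail does not depend on it.\<close>

lemma powi_times_lerch_phi:
  assumes "lerch_admissible z s" and "z \<noteq> 0" and "Re w + real M > 0" and "i \<le> int M"
  shows "z powi i * lerch_phi z s (w + of_int i) =
         (\<Sum>r\<in>{i..<int M}. (w + of_int r) powr (- s) * z powi r) + z ^ M * lerch_tail z s (w + of_nat M)"
proof -
  define N where "N = nat (int M - i)"
  have N: "int N = int M - i" using assms(4) by (simp add: N_def)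
  have M: "of_int i + of_nat N = (of_nat M :: complex)"
    using N by (metis add.commute diff_add_cancel of_int_add of_int_of_nat_eq)
  have "Re (w + of_int i + of_nat N) > 0"
    using assms(3) unfolding add.assoc M by simp
  note lerch_phi_expand[OF assms(1) this]
  then have "z powi i * lerch_phi z s (w + of_int i) =
      (\<Sum>r<N. (w + of_int (i + int r)) powr (- s) * z powi (i + int r)) + z powi (i + int N) * lerch_tail z s (w + of_nat M)"
    using assms(2) by (simp add: power_int_add sum_distrib_left M add.assoc algebra_simps)
  also have "(\<Sum>r<N. (w + of_int (i + int r)) powr (- s) * z powi (i + int r)) =
             (\<Sum>r\<in>{i..<int M}. (w + of_int r) powr (- s) * z powi r)"
    by (rule sum.reindex_bij_witness[of _ "\<lambda>r. nat (r - i)" "\<lambda>r. i + int r"]) (use N in auto)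
  finally show ?thesis using N by simp
qed

text \<open>Here \<open>c\<close> is \<open>i / n\<close> rounded up, so \<open>n * c\<close> is the
  first multiple of \<open>n\<close> from \<open>i\<close> on, and the sum over \<open>p\<close>
  leaves the indices \<open>n * t\<close> with \<open>t \<ge> c\<close>.\<close>

theorem lerch_phi_multiplication:
  fixes q \<zeta> s v :: complex
  assumes "n > 0" and prim: "\<And>r. \<zeta> powi r = 1 \<longleftrightarrow> int n dvd r"
    and adm: "lerch_admissible (q ^ n) s" and "q \<noteq> 0"
    and i: "int n * (c - 1) < i" "i \<le> int n * c"
  shows "(\<Sum>p<n. (q * \<zeta> ^ p) powi i * lerch_phi (q * \<zeta> ^ p) s (of_nat n * v + of_int i)) =
         of_nat n powr (1 - s) * ((q ^ n) powi c * lerch_phi (q ^ n) s (v + of_int c))"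
proof -
  define T where "T = nat (max c (\<lceil>- Re v\<rceil> + 1))"
  have T: "c \<le> int T" "Re v + real T > 0"
    unfolding T_def by linarith+
  \<comment> \<open>Cutting at a multiple of \<open>n\<close> makes the \<open>M\<close>-th powers
    independent of \<open>p\<close> and fits the tails to the multiplication formula.\<close>
  define M where "M = n * T"
  have "int n * c \<le> int n * int T"
    using T(1) by (intro mult_left_mono) auto
  with i(2) have iM: "i \<le> int M" by (simp add: M_def)
  have RM: "Re (of_nat n * v) + real M > 0"
    using T(2) assms(1) mult_pos_pos[of "real n" "Re v + real T"] by (simp add: M_def algebra_simps)
  have z0: "\<zeta> \<noteq> 0"
    using prim[of "int n"] assms(1) by (auto simp: power_0_left)
  have vM: "of_nat n * v + of_nat M = of_nat n * (v + of_nat T)"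
    by (simp add: M_def algebra_simps)
  have pow: "(q * \<zeta> ^ p) ^ M = (q ^ n) ^ T" for p
    unfolding M_def power_mult root_of_unity_power[OF assms(1) prim] ..
  have scale: "(of_nat n * v + of_int (int n * t)) powr (- s) * (of_nat n * q powi (int n * t)) =
      of_nat n powr (1 - s) * ((v + of_int t) powr (- s) * (q ^ n) powi t)" for t
  proof -
    have "(of_nat n * (v + of_int t)) powr (- s) = of_nat n powr (- s) * (v + of_int t) powr (- s)"
      by (rule powr_times_real_left) auto
    then show ?thesis
      using assms(1) by (simp add: powr_diff powr_minus power_int_power power_int_mult field_simps)
  qed
  have "(\<Sum>p<n. (q * \<zeta> ^ p) powi i * lerch_phi (q * \<zeta> ^ p) s (of_nat n * v + of_int i)) =
      (\<Sum>p<n. (\<Sum>r\<in>{i..<int M}. (of_nat n * v + of_int r) powr (- s) * (q * \<zeta> ^ p) powi r) +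
        (q ^ n) ^ T * lerch_tail (q * \<zeta> ^ p) s (of_nat n * (v + of_nat T)))"
    by (intro sum.cong refl, subst powi_times_lerch_phi[OF lerch_admissible_root[OF assms(1) prim adm] _ RM iM])
       (use assms(4) z0 in \<open>auto simp: pow vM\<close>)
  also have "\<dots> = (\<Sum>r\<in>{i..<int M}. (of_nat n * v + of_int r) powr (- s) * (\<Sum>p<n. (q * \<zeta> ^ p) powi r)) +
        (q ^ n) ^ T * (\<Sum>p<n. lerch_tail (q * \<zeta> ^ p) s (of_nat n * (v + of_nat T)))"
    by (subst sum.distrib, subst sum.swap) (simp add: sum_distrib_left)
  also have "(\<Sum>p<n. lerch_tail (q * \<zeta> ^ p) s (of_nat n * (v + of_nat T))) =
      of_nat n powr (1 - s) * lerch_tail (q ^ n) s (v + of_nat T)"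
    using T(2) by (intro lerch_tail_multiplication[OF assms(1) prim adm]) simp
  also have "(\<Sum>r\<in>{i..<int M}. (of_nat n * v + of_int r) powr (- s) * (\<Sum>p<n. (q * \<zeta> ^ p) powi r)) =
      (\<Sum>r\<in>{r\<in>{i..<int M}. int n dvd r}. (of_nat n * v + of_int r) powr (- s) * (of_nat n * q powi r))"
    unfolding sum_root_of_unity_powi[OF assms(1) prim]
    by (subst sum.inter_filter) (auto intro!: sum.cong)
  also have "\<dots> = (\<Sum>t\<in>{c..<int T}. (of_nat n * v + of_int (int n * t)) powr (- s) * (of_nat n * q powi (int n * t)))"
  proof (rule sum.reindex_bij_witness[of _ "\<lambda>t. int n * t" "\<lambda>r. r div int n"])
    fix r assume "r \<in> {r\<in>{i..<int M}. int n dvd r}"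
    then obtain t where t: "r = int n * t" and r: "i \<le> int n * t" "int n * t < int n * int T"
      by (auto simp: M_def)
    \<comment> \<open>The strict bound on \<open>i\<close> excludes multiples of \<open>n\<close>
      below \<open>n * c\<close>.\<close>
    from i(1) r(1) have "int n * (c - 1) < int n * t" by linarith
    with r(2) assms(1) have "c - 1 < t" "t < int T" by auto
    with t assms(1) show "int n * (r div int n) = r" "r div int n \<in> {c..<int T}"
      "(of_nat n * v + of_int (int n * (r div int n))) powr (- s) * (of_nat n * q powi (int n * (r div int n))) =
       (of_nat n * v + of_int r) powr (- s) * (of_nat n * q powi r)"
      by auto
  next
    fix t assume t: "t \<in> {c..<int T}"
    with assms(1) show "int n * t div int n = t" by simp
    have "int n * c \<le> int n * t" "int n * t < int n * int T"
      using t assms(1) by auto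
    with i(2) show "int n * t \<in> {r\<in>{i..<int M}. int n dvd r}"
      by (auto simp: M_def)
  qed
  also have "\<dots> + (q ^ n) ^ T * (of_nat n powr (1 - s) * lerch_tail (q ^ n) s (v + of_nat T)) =
      of_nat n powr (1 - s) * ((\<Sum>t\<in>{c..<int T}. (v + of_int t) powr (- s) * (q ^ n) powi t) +
        (q ^ n) ^ T * lerch_tail (q ^ n) s (v + of_nat T))"
    unfolding scale by (simp add: sum_distrib_left algebra_simps)
  also have "\<dots> = of_nat n powr (1 - s) * ((q ^ n) powi c * lerch_phi (q ^ n) s (v + of_int c))"
    by (subst powi_times_lerch_phi[OF adm _ T(2) T(1)]) (use assms(4) in auto)
  finally show ?thesis .
qed

section \<open>The roots of unity and powers in the theorem\<close>

text \<open>The power is 1 exactly if \<open>r * l / n\<close> is an integer, by periodicity of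
  \<open>exp\<close>; coprimality then removes \<open>l\<close>.\<close>

lemma primitive_root_of_unity_powi:
  assumes "n > 0" and "coprime l (int n)"
  shows "exp (2 * \<i> * of_real pi * of_int l / of_nat n) powi r = 1 \<longleftrightarrow> int n dvd r"
proof -
  have "exp (2 * \<i> * of_real pi * of_int l / of_nat n) powi r =
        exp (\<i> * of_real (2 * pi * (real_of_int (r * l) / real n)))"
    unfolding exp_power_int by (simp add: mult_ac)
  then have "exp (2 * \<i> * of_real pi * of_int l / of_nat n) powi r = 1 \<longleftrightarrow>
        (\<exists>k::int. 2 * pi * (real_of_int (r * l) / real n) = of_int (2 * k) * pi)"
    by (simp only: exp_eq_1) simp
  also have "\<dots> \<longleftrightarrow> (\<exists>k::int. real_of_int (r * l) = of_int (int n * k))"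
    using assms(1) by (intro arg_cong[where f = Ex] ext) (auto simp: field_simps)
  also have "\<dots> \<longleftrightarrow> int n dvd r * l"
    by (simp only: of_int_eq_iff dvd_def)
  also have "\<dots> \<longleftrightarrow> int n dvd r"
    using assms(2) by (simp add: coprime_commute coprime_dvd_mult_left_iff)
  finally show ?thesis .
qed

theorem theorem5p1:
  fixes n j :: nat and l :: int and k a m :: complex
  assumes "n > 0"
    and "coprime l (int n)"
    and "j \<in> {0..n - 1}"
    and "a \<noteq> 0"
    and "\<And>p. p \<in> {0..n - 1} \<Longrightarrow>
           lerch_defined (exp (2 * \<i> * (m * of_nat n + of_int l * of_nat p * of_real pi) / of_nat n))
             (- k) (- of_nat j - 1 / 2 * \<i> * Ln a)"
    and "\<And>p. p \<in> {0..n - 1} \<Longrightarrow>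
           lerch_defined (exp (2 * \<i> * (m * of_nat n + of_int l * of_nat p * of_real pi) / of_nat n))
             (- k) (of_nat j - 1 / 2 * \<i> * Ln a + 1)"
    and "lerch_defined (exp (2 * \<i> * m * of_nat n)) (- k) (1 - \<i> * Ln a / (2 * of_nat n))"
  shows "(\<Sum>p = 0..n - 1.
            exp (- (2 * \<i> * of_nat j * (of_real pi * of_int l * of_nat p + m * of_nat n) / of_nat n)) *
            (lerch_phi (exp (2 * \<i> * (m * of_nat n + of_int l * of_nat p * of_real pi) / of_nat n))
               (- k) (- of_nat j - 1 / 2 * \<i> * Ln a)
             + exp (2 * \<i> * (2 * of_nat j + 1) * (of_real pi * of_int l * of_nat p / of_nat n + m)) *
               lerch_phi (exp (2 * \<i> * (m * of_nat n + of_int l * of_nat p * of_real pi) / of_nat n))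
                 (- k) (of_nat j - 1 / 2 * \<i> * Ln a + 1)))
         = (2 * \<i>) powr (- k) * of_nat n *
           (ipowr (Ln a) k
            + 2 powr (k + 1) * (\<i> * of_nat n) powr k * exp (2 * \<i> * m * of_nat n) *
              lerch_phi (exp (2 * \<i> * m * of_nat n)) (- k) (1 - \<i> * Ln a / (2 * of_nat n)))"
proof -
  define q where "q = exp (2 * \<i> * m)"
  define \<zeta> where "\<zeta> = exp (2 * \<i> * of_real pi * of_int l / of_nat n)"
  define u where "u = Ln a / (2 * \<i>)"
  define v where "v = u / of_nat n"
  have prim: "\<zeta> powi r = 1 \<longleftrightarrow> int n dvd r" for r
    unfolding \<zeta>_def by (rule primitive_root_of_unity_powi) fact+
  have zp: "exp (2 * \<i> * (m * of_nat n + of_int l * of_nat p * of_real pi) / of_nat n) = q * \<zeta> ^ p" for p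
    unfolding q_def \<zeta>_def exp_of_nat_mult[symmetric] exp_add[symmetric]
    using assms(1) by (intro arg_cong[where f = exp]) (simp add: field_simps)
  have Z: "exp (2 * \<i> * m * of_nat n) = q ^ n"
    unfolding q_def exp_of_nat_mult[symmetric] by (simp add: mult_ac)
  \<comment> \<open>The prefactors are powers of \<open>z = q * \<zeta> ^ p\<close> with exponents
    \<open>- j\<close> and \<open>j + 1\<close>, equal to the shifts in the Lerch arguments.\<close>
  have pow_j: "exp (- (2 * \<i> * of_nat j * (of_real pi * of_int l * of_nat p + m * of_nat n) / of_nat n)) =
      (q * \<zeta> ^ p) powi (- int j)" for p
    unfolding zp[symmetric] exp_power_int
    using assms(1) by (intro arg_cong[where f = exp]) (simp add: field_simps)
  have pow_j1: "exp (- (2 * \<i> * of_nat j * (of_real pi * of_int l * of_nat p + m * of_nat n) / of_nat n)) *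
      exp (2 * \<i> * (2 * of_nat j + 1) * (of_real pi * of_int l * of_nat p / of_nat n + m)) =
      (q * \<zeta> ^ p) powi (int j + 1)" for p
    unfolding zp[symmetric] exp_power_int exp_add[symmetric]
    using assms(1) by (intro arg_cong[where f = exp]) (simp add: field_simps)
  have nv: "of_nat n * v = u" using assms(1) by (simp add: v_def)
  have u: "u = - (1 / 2 * \<i> * Ln a)" by (simp add: u_def field_simps)
  have arg1: "- of_nat j - 1 / 2 * \<i> * Ln a = of_nat n * v + of_int (- int j)"
    unfolding nv u by simp
  have arg2: "of_nat j - 1 / 2 * \<i> * Ln a + 1 = of_nat n * v + of_int (int j + 1)"
    unfolding nv u by simp
  have arg3: "1 - \<i> * Ln a / (2 * of_nat n) = v + of_int 1"
    unfolding v_def u by simp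
  \<comment> \<open>With \<open>Ln a = 0\<close> the first Lerch argument at \<open>p = 0\<close>
    would be the nonpositive integer \<open>- j\<close>.\<close>
  have "Ln a \<noteq> 0"
    using assms(5)[of 0] by (auto simp: lerch_defined_def)
  have adm: "lerch_admissible (q ^ n) (- k)"
    using assms(7) unfolding Z lerch_defined_def lerch_admissible_def by auto
  have q0: "q \<noteq> 0" by (simp add: q_def)
  have j: "j < n" using assms(1,3) by auto
  have expand: "E * (A + X * B) = P * A + Q * B" if "E = P" "E * X = Q" for E X A B P Q :: complex
    using that by (auto simp: distrib_left)
  note mult = lerch_phi_multiplication[OF assms(1) prim adm q0, where v = v]
  have "(\<Sum>p = 0..n - 1.
            exp (- (2 * \<i> * of_nat j * (of_real pi * of_int l * of_nat p + m * of_nat n) / of_nat n)) *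
            (lerch_phi (exp (2 * \<i> * (m * of_nat n + of_int l * of_nat p * of_real pi) / of_nat n))
               (- k) (- of_nat j - 1 / 2 * \<i> * Ln a)
             + exp (2 * \<i> * (2 * of_nat j + 1) * (of_real pi * of_int l * of_nat p / of_nat n + m)) *
               lerch_phi (exp (2 * \<i> * (m * of_nat n + of_int l * of_nat p * of_real pi) / of_nat n))
                 (- k) (of_nat j - 1 / 2 * \<i> * Ln a + 1))) =
      (\<Sum>p<n. (q * \<zeta> ^ p) powi (- int j) * lerch_phi (q * \<zeta> ^ p) (- k) (of_nat n * v + of_int (- int j))) +
      (\<Sum>p<n. (q * \<zeta> ^ p) powi (int j + 1) * lerch_phi (q * \<zeta> ^ p) (- k) (of_nat n * v + of_int (int j + 1)))"
    unfolding sum.distrib[symmetric] zp arg1 arg2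
  proof (rule sum.cong)
    show "{0..n - 1} = {..<n}" using assms(1) by auto
  qed (rule expand[OF pow_j pow_j1])
  \<comment> \<open>Rounding up gives \<open>c = 0\<close> from \<open>- n < - j \<le> 0\<close> and
    \<open>c = 1\<close> from \<open>0 < j + 1 \<le> n\<close>.\<close>
  also have "\<dots> = of_nat n powr (1 + k) * (lerch_phi (q ^ n) (- k) v + q ^ n * lerch_phi (q ^ n) (- k) (v + 1))"
    using mult[of 0 "- int j"] mult[of 1 "int j + 1"] j by (simp add: distrib_left)
  \<comment> \<open>The recurrence at \<open>v\<close> splits off \<open>v powr k\<close> and
    reproduces the second Lerch term, hence the factor 2.\<close>
  also have "\<dots> = of_nat n powr (1 + k) * (v powr k + 2 * q ^ n * lerch_phi (q ^ n) (- k) (v + 1))"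
    by (subst lerch_phi_rec[OF adm]) simp
  also have "\<dots> = of_nat n * u powr k + 2 * of_nat n * of_nat n powr k * q ^ n * lerch_phi (q ^ n) (- k) (v + 1)"
  proof -
    have "u powr k = of_nat n powr k * v powr k"
      unfolding nv[symmetric] by (rule powr_times_real_left) auto
    moreover have "of_nat n powr (1 + k) = of_nat n * of_nat n powr k"
      using assms(1) by (simp add: powr_add)
    ultimately show ?thesis by (simp add: algebra_simps)
  qed
  \<comment> \<open>Here the branch of \<open>ipowr\<close> matters: it gives the principal power of
    \<open>u\<close>, without an extra phase.\<close>
  also have "u powr k = (2 * \<i>) powr (- k) * ipowr (Ln a) k"
    unfolding u_def by (rule ipowr_two_ii[symmetric]) fact
  \<comment> \<open>The powers of 2 combine to 2 and those of \<open>\<i>\<close> cancel, once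
    positive reals are split off.\<close>
  also have "2 * of_nat n * of_nat n powr k = (2 * \<i>) powr (- k) * of_nat n * (2 powr (k + 1) * (\<i> * of_nat n) powr k)"
  proof -
    have 1: "(2 * \<i>) powr (- k) = 2 powr (- k) * \<i> powr (- k)"
      by (rule powr_times_real_left) auto
    have 2: "(\<i> * of_nat n) powr k = of_nat n powr k * \<i> powr k"
      unfolding mult.commute[of \<i>] by (rule powr_times_real_left) auto
    have "(2::complex) powr (- k) * 2 powr (k + 1) = 2" "\<i> powr (- k) * \<i> powr k = 1"
      by (simp_all flip: powr_add)
    then have "2 * of_nat n * of_nat n powr k =
        (2 powr (- k) * 2 powr (k + 1)) * (\<i> powr (- k) * \<i> powr k) * (of_nat n * of_nat n powr k)"
      by simp
    then show ?thesis
      unfolding 1 2 by (simp only: mult_ac)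
  qed
  finally show ?thesis
    unfolding Z arg3 by (simp add: algebra_simps)
qed

end
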